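(* Let $\{R_i\}_{i=0}^\infty$ and $\{T_i\}_{i=0}^\infty$ be increasing sequences of commutative rings with identity (that is, $R_i$ is a subring of $R_{i+1}$ and $T_i$ is a subring of $T_{i+1}$ for every $i\ge 0$) such that $R_i$ is a subring of $T_i$ for each $i\geq 0$, all these rings sharing the same identity element. Let $J_i=\bigcap_{k=0}^\infty(R_{i+k}:T_k)$ for each $i\geq 0$. Then $R_{\mathbb{N}_0}[[x]]$ is a locally associated subring of $T_{\mathbb{N}_0}[[x]]$ if and only if, for every $t_0\in T_0$ comaximal to $J_0$ (i.e., $t_0T_0+J_0=T_0$), there exists $u\in U(T_0)$ such that $t_0u$ is an element of $R_0$ comaximal to $J_0$ (i.e., $t_0u\in R_0$ and $t_0uR_0+J_0=R_0$).
   Context: $U(A)$ denotes the group of units of a commutative ring $A$ with identity. For subrings $A$ and $B$ of the same commutative ring (with $A$ not necessarily contained in $B$), the conductor is $(A:B)=\{a\in A : aB\subseteq A\}$. For an increasing sequence of commutative rings $\{A_i\}_{i=0}^\infty$ with union $A$, $A_{\mathbb{N}_0}[[x]]$ denotes the subring of $A[[x]]$ consisting of all formal power series whose coefficient of $x^i$ lies in $A_i$ for every $i\ge 0$. A subring $R$ (containing the identity) of a commutative ring $T$ with identity, with $I=(R:T)$, is a locally associated subring of $T$ if for every $t\in T$ with $tT+I=T$ there exist $r\in R$ with $rR+I=R$ and $u\in U(T)$ such that $t=ru$. *)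

theory Defs
  imports
    "HOL-Computational_Algebra.Formal_Power_Series"
    "HOL-Library.Set_Algebras"
begin

text \<open>
  A commutative ring with identity is a subring (containing 1) of an ambient
  type. The class \<open>comm_ring_1\<close> is avoided because it includes \<open>0 \<noteq> 1\<close>, hence
  excludes the zero ring; the sort \<open>{comm_ring, comm_monoid_mult}\<close> does not.
  The definitions only ask for \<open>{comm_ring, one}\<close>: the library declares \<open>fps\<close> a
  multiplicative monoid only over \<open>semiring_1\<close>, which again has \<open>0 \<noteq> 1\<close>.
\<close>

definition unital_subring :: "'a::{comm_ring, one} set \<Rightarrow> bool" where
  "unital_subring A \<longleftrightarrow> 1 \<in> A \<and> (\<forall>a\<in>A. \<forall>b\<in>A. a - b \<in> A \<and> a * b \<in> A)"

definition subring_of :: "'a::{comm_ring, one} set \<Rightarrow> 'a set \<Rightarrow> bool" where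
  "subring_of A B \<longleftrightarrow> unital_subring A \<and> unital_subring B \<and> A \<subseteq> B"

definition units_of_subring :: "'a::{comm_ring, one} set \<Rightarrow> 'a set" where
  "units_of_subring A = {u \<in> A. \<exists>v\<in>A. u * v = 1}"

text \<open>\<open>A\<close> need not be contained in \<open>B\<close>.\<close>

definition conductor :: "'a::{comm_ring, one} set \<Rightarrow> 'a set \<Rightarrow> 'a set" where
  "conductor A B = {a \<in> A. a *o B \<subseteq> A}"

text \<open>\<open>comaximal A a I\<close> means \<open>aA + I = A\<close>; here \<open>*o\<close> and \<open>+\<close> are the elementwise
  operations on sets.\<close>

definition comaximal :: "'a::{comm_ring, one} set \<Rightarrow> 'a \<Rightarrow> 'a set \<Rightarrow> bool" where
  "comaximal A a I \<longleftrightarrow> a *o A + I = A"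

definition locally_associated :: "'a::{comm_ring, one} set \<Rightarrow> 'a set \<Rightarrow> bool" where
  "locally_associated R T \<longleftrightarrow> subring_of R T \<and>
     (\<forall>t\<in>T. comaximal T t (conductor R T) \<longrightarrow>
        (\<exists>r\<in>R. comaximal R r (conductor R T) \<and> (\<exists>u\<in>units_of_subring T. t = r * u)))"

definition graded_fps :: "(nat \<Rightarrow> 'a::{comm_ring, one} set) \<Rightarrow> 'a fps set" where
  "graded_fps A = {f. \<forall>i. fps_nth f i \<in> A i}"

end

theory Submission
  imports Defs
begin

text \<open>
  Write \<open>\<R>\<close> and \<open>\<T>\<close> for the rings of power series with \<open>n\<close>-th coefficient in \<open>R n\<close> and
  \<open>T n\<close>. Testing a power series against monomials shows that the conductor \<open>(\<R> : \<T>)\<close> is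
  itself graded: it consists of the series with \<open>n\<close>-th coefficient in \<open>J n\<close>
  (\<open>conductor_graded_fps\<close>). Comaximality then only needs a witness \<open>a b + j = 1\<close>
  (\<open>comaximal_iff\<close>), and a series in \<open>\<T>\<close> with constant term 1 is a unit of \<open>\<T>\<close>
  (\<open>graded_fps_unit\<close>).

  If \<open>\<R>\<close> is locally associated in \<open>\<T>\<close>, the condition on \<open>T 0\<close> results from viewing \<open>t\<^sub>0\<close> as
  a constant series and reading off constant terms of the factorization obtained in \<open>\<T>\<close>.

  For the converse, the hypothesis allows multiplying a series in \<open>\<T>\<close> that is comaximal to
  the conductor by a constant unit, so that its constant term \<open>p\<close> lies in \<open>R 0\<close> and
  \<open>p a + j = 1\<close> for some \<open>a \<in> R 0\<close>, \<open>j \<in> J 0\<close>. If \<open>t = p + s\<close> with \<open>s\<close> of constant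
  term 0, then \<open>s = p a s + j s\<close>, hence \<open>t = p (1 + a s) + j s\<close>. Since \<open>1 + a s\<close> is a unit,
  \<open>t\<close> is associated to \<open>p + j s / (1 + a s)\<close>. The second summand lies in the conductor
  because \<open>j\<close> does; so this series lies in \<open>\<R>\<close> and is comaximal to the conductor because
  \<open>p\<close> is (\<open>associate_in_graded_fps\<close>).
\<close>

section \<open>Subrings and comaximality\<close>

lemma unital_subring_one: "unital_subring A \<Longrightarrow> 1 \<in> A"
  by (simp add: unital_subring_def)

lemma unital_subring_diff: "unital_subring A \<Longrightarrow> a \<in> A \<Longrightarrow> b \<in> A \<Longrightarrow> a - b \<in> A"
  by (simp add: unital_subring_def)

lemma unital_subring_mult: "unital_subring A \<Longrightarrow> a \<in> A \<Longrightarrow> b \<in> A \<Longrightarrow> a * b \<in> A"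
  by (simp add: unital_subring_def)

lemma unital_subring_zero:
  assumes "unital_subring A"
  shows "0 \<in> A"
  using unital_subring_diff[OF assms unital_subring_one unital_subring_one] assms by simp

lemma unital_subring_minus: "unital_subring A \<Longrightarrow> a \<in> A \<Longrightarrow> - a \<in> A"
  using unital_subring_diff[of A 0 a] unital_subring_zero by auto

lemma unital_subring_add: "unital_subring A \<Longrightarrow> a \<in> A \<Longrightarrow> b \<in> A \<Longrightarrow> a + b \<in> A"
  using unital_subring_diff[of A a "- b"] unital_subring_minus by auto

lemma unital_subring_sum:
  "unital_subring A \<Longrightarrow> (\<And>i. i \<in> S \<Longrightarrow> f i \<in> A) \<Longrightarrow> sum f S \<in> A"
  by (induction S rule: infinite_finite_induct)
    (simp_all add: unital_subring_zero unital_subring_add)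

lemmas unital_subring_closed =
  unital_subring_one unital_subring_zero unital_subring_diff unital_subring_minus
  unital_subring_add unital_subring_mult unital_subring_sum

text \<open>
  The neutrality of 1 is a hypothesis because the lemma is applied both to the coefficients
  and to power series, and \<open>comm_ring\<close> with \<open>one\<close> is the common sort of these types.
\<close>

lemma comaximal_iff:
  fixes A :: "'a::{comm_ring, one} set"
  assumes one: "\<And>x :: 'a. 1 * x = x"
    and A: "unital_subring A" and I: "I \<subseteq> A" "\<And>x y. x \<in> I \<Longrightarrow> y \<in> A \<Longrightarrow> x * y \<in> I"
    and a: "a \<in> A"
  shows "comaximal A a I \<longleftrightarrow> (\<exists>b\<in>A. \<exists>j\<in>I. a * b + j = 1)"
proof
  assume "comaximal A a I"
  then have "1 \<in> a *o A + I"
    using A by (simp add: comaximal_def unital_subring_one)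
  then show "\<exists>b\<in>A. \<exists>j\<in>I. a * b + j = 1"
    by (force simp: set_plus_def elt_set_times_def)
next
  assume "\<exists>b\<in>A. \<exists>j\<in>I. a * b + j = 1"
  then obtain b j where bj: "b \<in> A" "j \<in> I" "a * b + j = 1"
    by blast
  have "x \<in> a *o A + I" if x: "x \<in> A" for x
  proof -
    have "x = (a * b + j) * x"
      using bj one by simp
    also have "\<dots> = a * (b * x) + j * x"
      by (simp add: algebra_simps)
    finally show ?thesis
      using unital_subring_mult[OF A bj(1) x] I(2)[OF bj(2) x]
      by (auto simp: set_plus_def elt_set_times_def)
  qed
  moreover have "a *o A + I \<subseteq> A"
    using A I(1) a by (auto simp: set_plus_def elt_set_times_def unital_subring_closed)
  ultimately show "comaximal A a I"
    by (auto simp: comaximal_def)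
qed

section \<open>Graded power series over an increasing sequence of rings\<close>

lemma graded_fps_nth: "f \<in> graded_fps A \<Longrightarrow> fps_nth f n \<in> A n"
  by (simp add: graded_fps_def)

lemma graded_fpsI: "(\<And>n. fps_nth f n \<in> A n) \<Longrightarrow> f \<in> graded_fps A"
  by (simp add: graded_fps_def)

locale increasing_rings =
  fixes A :: "nat \<Rightarrow> 'a::{comm_ring, comm_monoid_mult} set"
  assumes Suc_subring: "\<And>i. subring_of (A i) (A (Suc i))"
begin

lemma subring: "unital_subring (A i)"
  using Suc_subring by (simp add: subring_of_def)

lemma mono: "i \<le> k \<Longrightarrow> A i \<subseteq> A k"
  by (rule lift_Suc_mono_le[of A]) (use Suc_subring in \<open>auto simp: subring_of_def\<close>)

lemma mult_nth_mem:
  assumes "x \<in> A i" "y \<in> A k" "i \<le> n" "k \<le> n"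
  shows "x * y \<in> A n"
  using assms mono subring unital_subring_mult by blast

lemma fps_const_mem: "c \<in> A 0 \<Longrightarrow> fps_const c \<in> graded_fps A"
  by (rule graded_fpsI) (use mono[of 0] in \<open>auto simp: unital_subring_zero subring\<close>)

lemma unital_subring_graded_fps: "unital_subring (graded_fps A)"
  unfolding unital_subring_def
proof (intro conjI ballI)
  show "1 \<in> graded_fps A"
    by (rule graded_fpsI) (simp add: subring unital_subring_closed)
next
  fix f g
  assume f: "f \<in> graded_fps A" and g: "g \<in> graded_fps A"
  show "f - g \<in> graded_fps A"
    by (rule graded_fpsI) (simp add: subring unital_subring_diff graded_fps_nth f g)
  show "f * g \<in> graded_fps A"
  proof (rule graded_fpsI)
    fix n
    have "fps_nth f i * fps_nth g (n - i) \<in> A n" if "i \<in> {0..n}" for i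
      using that by (intro mult_nth_mem[OF graded_fps_nth[OF f] graded_fps_nth[OF g]]) auto
    then show "fps_nth (f * g) n \<in> A n"
      unfolding fps_mult_nth by (rule unital_subring_sum[OF subring])
  qed
qed

text \<open>
  The recursion for the coefficients of the inverse never divides, and the \<open>n\<close>-th step only
  combines coefficients of index at most \<open>n\<close>, which all lie in \<open>A n\<close>.
\<close>

lemma graded_fps_unit:
  assumes f: "f \<in> graded_fps A" and f0: "fps_nth f 0 = 1"
  shows "f \<in> units_of_subring (graded_fps A)"
proof -
  define c where "c = fps_right_inverse_constructor f 1"
  have "c n \<in> A n" for n
  proof (induction n rule: less_induct)
    case (less n)
    show ?case
    proof (cases n)
      case 0
      then show ?thesis
        by (simp add: c_def subring unital_subring_one)
    next
      case (Suc m)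
      have "fps_nth f i * c (n - i) \<in> A n" if "i \<in> {1..n}" for i
        using that Suc by (intro mult_nth_mem[OF graded_fps_nth[OF f] less.IH]) auto
      moreover have "c n = - (\<Sum>i=1..n. fps_nth f i * c (n - i))"
        by (simp add: Suc c_def)
      ultimately show ?thesis
        using subring by (simp only: unital_subring_minus unital_subring_sum)
    qed
  qed
  then have "Abs_fps c \<in> graded_fps A"
    by (intro graded_fpsI) simp
  moreover have "f * Abs_fps c = 1"
  proof (rule fps_ext)
    fix n
    show "fps_nth (f * Abs_fps c) n = fps_nth 1 n"
    proof (cases n)
      case 0
      then show ?thesis
        by (simp add: c_def f0)
    next
      case (Suc m)
      have "fps_nth (f * Abs_fps c) n = c n + (\<Sum>i=1..n. fps_nth f i * c (n - i))"
        by (simp add: fps_mult_nth sum.atLeast_Suc_atMost f0)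
      also have "c n = - (\<Sum>i=1..n. fps_nth f i * c (n - i))"
        by (simp add: Suc c_def)
      finally show ?thesis
        by (simp add: Suc)
    qed
  qed
  ultimately show ?thesis
    using f by (auto simp: units_of_subring_def)
qed

end

section \<open>The conductor of a pair of graded power series rings\<close>

locale increasing_ring_pair = R: increasing_rings R + T: increasing_rings T
  for R T :: "nat \<Rightarrow> 'a::{comm_ring, comm_monoid_mult} set" +
  assumes R_subring_T: "\<And>i. subring_of (R i) (T i)"
begin

definition J :: "nat \<Rightarrow> 'a set" where
  "J i = (\<Inter>k. conductor (R (i + k)) (T k))"

lemma R_subset_T: "R i \<subseteq> T i"
  using R_subring_T by (simp add: subring_of_def)

lemma graded_fps_subset: "graded_fps R \<subseteq> graded_fps T"
  using R_subset_T by (auto simp: graded_fps_def)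

text \<open>
  Since \<open>R i\<close> is contained in every \<open>R (i + k)\<close>, only the multiplication conditions of the
  conductors depend on \<open>k\<close>.
\<close>

lemma J_iff: "x \<in> J i \<longleftrightarrow> x \<in> R i \<and> (\<forall>k. \<forall>y\<in>T k. x * y \<in> R (i + k))"
proof -
  have "x \<in> R i" if "x \<in> J i"
    using that by (auto simp: J_def conductor_def dest: spec[of _ 0])
  moreover have "x \<in> R (i + k)" if "x \<in> R i" for k
    using that R.mono[of i "i + k"] by auto
  ultimately show ?thesis
    by (fastforce simp: J_def conductor_def elt_set_times_def)
qed

lemma J_subset_R: "J i \<subseteq> R i"
  by (auto simp: J_iff)

text \<open>
  The bound is \<open>i + k\<close> because a product of elements of \<open>T k\<close> and \<open>T m\<close> lies in \<open>T (k + m)\<close>.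
  For \<open>i = k = 0\<close> it says that \<open>J 0\<close> absorbs multiplication by \<open>T 0\<close>.
\<close>

lemma J_mult:
  assumes x: "x \<in> J i" and y: "y \<in> T k"
  shows "x * y \<in> J (i + k)"
  unfolding J_iff
proof (intro conjI allI ballI)
  show "x * y \<in> R (i + k)"
    using x y by (simp add: J_iff)
next
  fix m z
  assume "z \<in> T m"
  then have "y * z \<in> T (k + m)"
    by (intro T.mult_nth_mem[OF y]) auto
  then show "x * y * z \<in> R (i + k + m)"
    using x by (simp add: J_iff mult.assoc add.assoc)
qed

lemma J_0_mult: "x \<in> J 0 \<Longrightarrow> y \<in> T 0 \<Longrightarrow> x * y \<in> J 0"
  using J_mult[of x 0 y 0] by simp

text \<open>
  A product of \<open>f\<close> with the monomial of degree \<open>k\<close> and coefficient \<open>y \<in> T k\<close> moves \<open>f\<^sub>i * y\<close>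
  to degree \<open>i + k\<close>; this is why the conductor imposes exactly the conditions defining \<open>J i\<close>.
\<close>

lemma conductor_graded_fps: "conductor (graded_fps R) (graded_fps T) = graded_fps J"
proof (rule set_eqI, rule iffI)
  fix f
  assume f: "f \<in> conductor (graded_fps R) (graded_fps T)"
  show "f \<in> graded_fps J"
  proof (rule graded_fpsI, unfold J_iff, intro conjI allI ballI)
    fix i
    show "fps_nth f i \<in> R i"
      using f by (auto simp: conductor_def graded_fps_nth)
    fix k y
    assume y: "y \<in> T k"
    define g where "g = Abs_fps (\<lambda>n. if n = k then y else 0)"
    have "g \<in> graded_fps T"
      using y by (intro graded_fpsI) (simp add: g_def T.subring unital_subring_zero)
    then have "f * g \<in> graded_fps R"
      using f by (auto simp: conductor_def elt_set_times_def)
    moreover have "fps_nth (f * g) (i + k) = fps_nth f i * y"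
    proof -
      have "fps_nth (f * g) (i + k)
          = (\<Sum>n=0..i + k. if n = i then fps_nth f i * y else 0)"
        unfolding fps_mult_nth by (rule sum.cong) (auto simp: g_def)
      then show ?thesis
        by simp
    qed
    ultimately show "fps_nth f i * y \<in> R (i + k)"
      using graded_fps_nth by metis
  qed
next
  fix f
  assume f: "f \<in> graded_fps J"
  have "f * g \<in> graded_fps R" if g: "g \<in> graded_fps T" for g
  proof (rule graded_fpsI)
    fix n
    have "fps_nth f i * fps_nth g (n - i) \<in> R n" if "i \<in> {0..n}" for i
      using J_mult[OF graded_fps_nth[OF f] graded_fps_nth[OF g], of i "n - i"] that J_subset_R
      by auto
    then show "fps_nth (f * g) n \<in> R n"
      unfolding fps_mult_nth by (rule unital_subring_sum[OF R.subring])
  qed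
  moreover have "f \<in> graded_fps R"
    using f J_subset_R by (auto simp: graded_fps_def)
  ultimately show "f \<in> conductor (graded_fps R) (graded_fps T)"
    by (auto simp: conductor_def elt_set_times_def)
qed

lemma graded_fps_J_subset: "graded_fps J \<subseteq> graded_fps R"
  using J_subset_R by (auto simp: graded_fps_def)

lemma fps_const_mem_J:
  assumes "c \<in> J 0"
  shows "fps_const c \<in> graded_fps J"
proof (rule graded_fpsI)
  fix n
  \<comment> \<open>The product with the element 0 of \<open>T n\<close> shows that 0 lies in \<open>J n\<close>.\<close>
  have "c * 0 \<in> J (0 + n)"
    by (rule J_mult[OF assms]) (simp add: T.subring unital_subring_zero)
  then show "fps_nth (fps_const c) n \<in> J n"
    using assms by simp
qed

lemma graded_fps_J_mult:
  assumes f: "f \<in> graded_fps J" and g: "g \<in> graded_fps T"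
  shows "f * g \<in> graded_fps J"
proof -
  have "f * g * h \<in> graded_fps R" if "h \<in> graded_fps T" for h
    using f unital_subring_mult[OF T.unital_subring_graded_fps g that]
    by (auto simp: conductor_graded_fps[symmetric] conductor_def elt_set_times_def mult.assoc)
  moreover have "f * g \<in> graded_fps R"
    using f g by (auto simp: conductor_graded_fps[symmetric] conductor_def elt_set_times_def)
  ultimately show ?thesis
    by (auto simp: conductor_graded_fps[symmetric] conductor_def elt_set_times_def)
qed

lemma comaximal_R0_iff:
  "a \<in> R 0 \<Longrightarrow> comaximal (R 0) a (J 0) \<longleftrightarrow> (\<exists>b\<in>R 0. \<exists>j\<in>J 0. a * b + j = 1)"
  by (rule comaximal_iff[OF _ R.subring J_subset_R]) (use R_subset_T J_0_mult in auto)

lemma comaximal_T0_iff: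
  "a \<in> T 0 \<Longrightarrow> comaximal (T 0) a (J 0) \<longleftrightarrow> (\<exists>b\<in>T 0. \<exists>j\<in>J 0. a * b + j = 1)"
  by (rule comaximal_iff[OF _ T.subring]) (use J_subset_R R_subset_T J_0_mult in auto)

lemma comaximal_graded_fps_R_iff:
  "f \<in> graded_fps R \<Longrightarrow> comaximal (graded_fps R) f (graded_fps J) \<longleftrightarrow>
     (\<exists>g\<in>graded_fps R. \<exists>j\<in>graded_fps J. f * g + j = 1)"
  using graded_fps_J_subset graded_fps_subset graded_fps_J_mult
  by (intro comaximal_iff fps_one_mult R.unital_subring_graded_fps) blast+

lemma comaximal_graded_fps_T_iff:
  "f \<in> graded_fps T \<Longrightarrow> comaximal (graded_fps T) f (graded_fps J) \<longleftrightarrow>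
     (\<exists>g\<in>graded_fps T. \<exists>j\<in>graded_fps J. f * g + j = 1)"
  using graded_fps_J_subset graded_fps_subset graded_fps_J_mult
  by (intro comaximal_iff fps_one_mult T.unital_subring_graded_fps) blast+

section \<open>Transfer between constant terms and power series\<close>

text \<open>
  Let \<open>p\<close> be the constant term of \<open>t\<close>. With \<open>t = p + s\<close> and \<open>p * a + j = 1\<close> one has
  \<open>t = p * (1 + a * s) + j * s\<close>, so dividing by the unit \<open>1 + a * s\<close> changes \<open>p\<close> only by a
  multiple of \<open>j\<close>.
\<close>

lemma associate_in_graded_fps:
  assumes t: "t \<in> graded_fps T" and p: "fps_nth t 0 \<in> R 0"
    and comax: "comaximal (R 0) (fps_nth t 0) (J 0)"
  obtains r u where "r \<in> graded_fps R" "comaximal (graded_fps R) r (graded_fps J)"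
    "u \<in> units_of_subring (graded_fps T)" "t = r * u"
proof -
  obtain a j where a: "a \<in> R 0" and j: "j \<in> J 0" and paj: "fps_nth t 0 * a + j = 1"
    using comax comaximal_R0_iff[OF p] by blast
  define P where "P = fps_const (fps_nth t 0)"
  define A where "A = fps_const a"
  define C where "C = fps_const j"
  define s where "s = t - P"
  define u where "u = 1 + A * s"
  note T_closed = unital_subring_closed[OF T.unital_subring_graded_fps]
  have P: "P \<in> graded_fps R" and A: "A \<in> graded_fps R" and C: "C \<in> graded_fps J"
    using p a j by (simp_all add: P_def A_def C_def R.fps_const_mem fps_const_mem_J)
  have PAC: "P * A + C = 1"
    using paj by (simp add: P_def A_def C_def)
  have s: "s \<in> graded_fps T"
    using t P graded_fps_subset by (auto simp: s_def intro: T_closed)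
  have u: "u \<in> units_of_subring (graded_fps T)"
  proof (rule T.graded_fps_unit)
    show "u \<in> graded_fps T"
      using s A graded_fps_subset by (auto simp: u_def intro!: T_closed)
    show "fps_nth u 0 = 1"
      by (simp add: u_def s_def P_def)
  qed
  then obtain v where v: "v \<in> graded_fps T" "u * v = 1"
    by (auto simp: units_of_subring_def)
  define e where "e = C * (s * v)"
  have e: "e \<in> graded_fps J"
    unfolding e_def by (intro graded_fps_J_mult C T_closed s v)
  have r: "P + e \<in> graded_fps R"
    using P e graded_fps_J_subset
    by (auto intro: unital_subring_add[OF R.unital_subring_graded_fps])
  have "(P + e) * A + C * (1 - s * v * A) = 1"
    using PAC by (simp add: e_def algebra_simps fps_one_mult)
  moreover have "C * (1 - s * v * A) \<in> graded_fps J"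
    using A graded_fps_subset by (intro graded_fps_J_mult C T_closed s v) auto
  ultimately have "comaximal (graded_fps R) (P + e) (graded_fps J)"
    using comaximal_graded_fps_R_iff[OF r] A by blast
  moreover have "t = (P + e) * u"
  proof -
    have "(P + e) * u = P * u + C * s * (u * v)"
      by (simp add: e_def algebra_simps)
    also have "\<dots> = P + (P * A + C) * s"
      unfolding v(2) by (simp add: u_def algebra_simps fps_one_mult)
    also have "\<dots> = t"
      unfolding PAC by (simp add: s_def fps_one_mult)
    finally show ?thesis ..
  qed
  ultimately show thesis
    using that r u by blast
qed

lemma units_of_subring_graded_fps_nth_0:
  assumes "u \<in> units_of_subring (graded_fps T)"
  obtains v where "v \<in> units_of_subring (T 0)" "fps_nth u 0 * v = 1"
proof -
  obtain w where w: "u \<in> graded_fps T" "w \<in> graded_fps T" "u * w = 1"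
    using assms by (auto simp: units_of_subring_def)
  have "fps_nth u 0 * fps_nth w 0 = 1"
    using arg_cong[OF w(3), of "\<lambda>f. fps_nth f 0"] by simp
  moreover from this have "fps_nth w 0 \<in> units_of_subring (T 0)"
    using w graded_fps_nth by (auto simp: units_of_subring_def mult.commute)
  ultimately show thesis
    using that by blast
qed

lemma units_of_subring_graded_fps_mult_const:
  assumes u: "u \<in> units_of_subring (graded_fps T)" and v: "v \<in> units_of_subring (T 0)"
  shows "u * fps_const v \<in> units_of_subring (graded_fps T)"
proof -
  obtain u' where u': "u' \<in> graded_fps T" "u * u' = 1"
    using u by (auto simp: units_of_subring_def)
  obtain v' where v': "v' \<in> T 0" "v * v' = 1"
    using v by (auto simp: units_of_subring_def)
  have "u * fps_const v * (u' * fps_const v') = (u * u') * (fps_const v * fps_const v')"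
    by (simp only: mult_ac)
  also have "\<dots> = 1"
    using u' v' by (simp add: fps_one_mult)
  finally have "u * fps_const v * (u' * fps_const v') = 1" .
  moreover have "u * fps_const v \<in> graded_fps T" "u' * fps_const v' \<in> graded_fps T"
    using u v u' v' by (auto simp: units_of_subring_def
        intro!: T.fps_const_mem unital_subring_mult[OF T.unital_subring_graded_fps])
  ultimately show ?thesis
    by (auto simp: units_of_subring_def)
qed

lemma locally_associated_graded_fps_iff:
  "locally_associated (graded_fps R) (graded_fps T) \<longleftrightarrow>
    (\<forall>t\<in>T 0. comaximal (T 0) t (J 0) \<longrightarrow>
      (\<exists>u\<in>units_of_subring (T 0). t * u \<in> R 0 \<and> comaximal (R 0) (t * u) (J 0)))"
  (is "_ \<longleftrightarrow> ?const")
proof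
  assume loc: "locally_associated (graded_fps R) (graded_fps T)"
  show ?const
  proof (intro ballI impI)
    fix t
    assume t: "t \<in> T 0" and comax: "comaximal (T 0) t (J 0)"
    obtain b j where b: "b \<in> T 0" and j: "j \<in> J 0" and tbj: "t * b + j = 1"
      using comax comaximal_T0_iff[OF t] by blast
    have "fps_const t * fps_const b + fps_const j = 1"
      using tbj by simp
    then have "comaximal (graded_fps T) (fps_const t) (graded_fps J)"
      using comaximal_graded_fps_T_iff T.fps_const_mem t b fps_const_mem_J[OF j] by blast
    then obtain r u where r: "r \<in> graded_fps R"
      and comax_r: "comaximal (graded_fps R) r (graded_fps J)"
      and u: "u \<in> units_of_subring (graded_fps T)" and tru: "fps_const t = r * u"
      using loc T.fps_const_mem[OF t]
      unfolding locally_associated_def conductor_graded_fps by blast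
    obtain v where v: "v \<in> units_of_subring (T 0)" "fps_nth u 0 * v = 1"
      using units_of_subring_graded_fps_nth_0[OF u] .
    have "t = fps_nth r 0 * fps_nth u 0"
      using arg_cong[OF tru, of "\<lambda>f. fps_nth f 0"] by simp
    then have tv: "t * v = fps_nth r 0"
      using v by (simp add: mult.assoc)
    have r0: "fps_nth r 0 \<in> R 0"
      using r by (rule graded_fps_nth)
    obtain g h where g: "g \<in> graded_fps R" and h: "h \<in> graded_fps J" and rgh: "r * g + h = 1"
      using comax_r comaximal_graded_fps_R_iff[OF r] by blast
    have "fps_nth r 0 * fps_nth g 0 + fps_nth h 0 = 1"
      using arg_cong[OF rgh, of "\<lambda>f. fps_nth f 0"] by simp
    then have "comaximal (R 0) (fps_nth r 0) (J 0)"
      using comaximal_R0_iff[OF r0] graded_fps_nth[OF g] graded_fps_nth[OF h] by blast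
    then show "\<exists>u\<in>units_of_subring (T 0). t * u \<in> R 0 \<and> comaximal (R 0) (t * u) (J 0)"
      using v(1) r0 unfolding tv[symmetric] by blast
  qed
next
  assume const: ?const
  show "locally_associated (graded_fps R) (graded_fps T)"
    unfolding locally_associated_def conductor_graded_fps
  proof (intro conjI ballI impI)
    show "subring_of (graded_fps R) (graded_fps T)"
      by (simp add: subring_of_def R.unital_subring_graded_fps T.unital_subring_graded_fps
          graded_fps_subset)
  next
    fix t
    assume t: "t \<in> graded_fps T" and comax: "comaximal (graded_fps T) t (graded_fps J)"
    obtain g h where g: "g \<in> graded_fps T" and h: "h \<in> graded_fps J" and tgh: "t * g + h = 1"
      using comax comaximal_graded_fps_T_iff[OF t] by blast
    have t0: "fps_nth t 0 \<in> T 0"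
      using t by (rule graded_fps_nth)
    have "fps_nth t 0 * fps_nth g 0 + fps_nth h 0 = 1"
      using arg_cong[OF tgh, of "\<lambda>f. fps_nth f 0"] by simp
    then have "comaximal (T 0) (fps_nth t 0) (J 0)"
      using comaximal_T0_iff[OF t0] graded_fps_nth[OF g] graded_fps_nth[OF h] by blast
    then obtain c where c: "c \<in> units_of_subring (T 0)" and tc: "fps_nth t 0 * c \<in> R 0"
      "comaximal (R 0) (fps_nth t 0 * c) (J 0)"
      using const t0 by blast
    obtain d where d: "c \<in> T 0" "d \<in> T 0" "c * d = 1"
      using c by (auto simp: units_of_subring_def)
    have "t * fps_const c \<in> graded_fps T"
      by (intro unital_subring_mult[OF T.unital_subring_graded_fps] t T.fps_const_mem d)
    moreover have "fps_nth (t * fps_const c) 0 = fps_nth t 0 * c"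
      by simp
    ultimately obtain r u where r: "r \<in> graded_fps R"
      "comaximal (graded_fps R) r (graded_fps J)"
      and u: "u \<in> units_of_subring (graded_fps T)" and tcru: "t * fps_const c = r * u"
      using associate_in_graded_fps[of "t * fps_const c"] tc by metis
    have "d \<in> units_of_subring (T 0)"
      using d by (auto simp: units_of_subring_def mult.commute)
    then have "u * fps_const d \<in> units_of_subring (graded_fps T)"
      by (rule units_of_subring_graded_fps_mult_const[OF u])
    moreover have "t = r * (u * fps_const d)"
    proof -
      have "r * (u * fps_const d) = t * (fps_const c * fps_const d)"
        using tcru by (simp only: mult.assoc[symmetric])
      also have "\<dots> = t"
        using d by (simp add: fps_one_mult)
      finally show ?thesis ..
    qed
    ultimately show "\<exists>r\<in>graded_fps R. comaximal (graded_fps R) r (graded_fps J) \<and>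
        (\<exists>u\<in>units_of_subring (graded_fps T). t = r * u)"
      using r by blast
  qed
qed

end

theorem theorem5p13:
  fixes R T J :: "nat \<Rightarrow> 'a::{comm_ring, comm_monoid_mult} set"
  assumes "\<And>i. subring_of (R i) (R (Suc i))"
    and "\<And>i. subring_of (T i) (T (Suc i))"
    and "\<And>i. subring_of (R i) (T i)"
    and "\<And>i. J i = (\<Inter>k. conductor (R (i + k)) (T k))"
  shows "locally_associated (graded_fps R) (graded_fps T) \<longleftrightarrow>
    (\<forall>t\<^sub>0\<in>T 0. comaximal (T 0) t\<^sub>0 (J 0) \<longrightarrow>
      (\<exists>u\<in>units_of_subring (T 0).
         t\<^sub>0 * u \<in> R 0 \<and> comaximal (R 0) (t\<^sub>0 * u) (J 0)))"
proof -
  interpret P: increasing_ring_pair R T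
    by unfold_locales (use assms in auto)
  have "P.J = J"
    by (rule ext) (simp add: P.J_def assms(4))
  then show ?thesis
    using P.locally_associated_graded_fps_iff by simp
qed

end
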